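(* Let $d\ge1$, $r_1,\dots,r_d\in\mathbb{Z}$, and let $(U_n)_{n\ge0}$ be a sequence of integers with $U_n=r_1U_{n-1}+\cdots+r_dU_{n-d}$ for all $n\ge d$. Suppose the characteristic polynomial $C(x)=x^d-r_1x^{d-1}-\cdots-r_d$ is irreducible over $\mathbb{F}_p$ for infinitely many primes $p$. Let $\alpha_0,\dots,\alpha_{d-1}$ be the roots of $C$ and $l_0,\dots,l_{d-1}$ the constants with $U_n=\sum_{i=0}^{d-1}l_i\alpha_i^n$ for all $n\ge0$. Then $(U_n)_{n\ge1}$ almost satisfies the Dold condition if and only if $l_0=l_1=\cdots=l_{d-1}$.
   Context: A sequence of integers $(A_n)_{n\ge1}$ satisfies the Dold condition if $n\mid\sum_{d\mid n}\mu(d)A_{n/d}$ for every $n\in\mathbb{N}_+$ ($\mu$ the Möbius function). It almost satisfies the Dold condition if there is $c\in\mathbb{N}_+$ such that $(cA_n)_{n\ge1}$ satisfies the Dold condition. *)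

theory Defs
  imports
    Complex_Main
    "HOL-Computational_Algebra.Squarefree"
    "Berlekamp_Zassenhaus.Poly_Mod"
begin

definition moebius :: "nat \<Rightarrow> int" where
  "moebius n = (if squarefree n then (- 1) ^ card (prime_factors n) else 0)"

(* The sequences are indexed by the positive integers; the value A 0 is never used. *)
definition Dold_condition :: "(nat \<Rightarrow> int) \<Rightarrow> bool" where
  "Dold_condition A \<longleftrightarrow>
     (\<forall>n\<ge>1. int n dvd (\<Sum>k | k dvd n. moebius k * A (n div k)))"

definition almost_Dold_condition :: "(nat \<Rightarrow> int) \<Rightarrow> bool" where
  "almost_Dold_condition A \<longleftrightarrow> (\<exists>c::nat. c \<ge> 1 \<and> Dold_condition (\<lambda>n. int c * A n))"

definition recurrence_poly :: "nat \<Rightarrow> (nat \<Rightarrow> int) \<Rightarrow> int poly" where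
  "recurrence_poly d r = monom 1 d - (\<Sum>i=1..d. monom (r i) (d - i))"

(* poly_mod.irreducible_m m f says that the reduction of f is irreducible in (Z/mZ)[x]:
   it is nonzero, not a unit, and in any factorization modulo m one factor is a unit
   modulo m. *)
definition irreducible_over_Fp :: "nat \<Rightarrow> int poly \<Rightarrow> bool" where
  "irreducible_over_Fp p f \<longleftrightarrow> poly_mod.irreducible_m (int p) f"

end

theory Submission
  imports Defs "HOL-Computational_Algebra.Polynomial_FPS"
begin

text \<open>
  Let \<open>T n\<close> be the power sums of the roots of \<open>C\<close>. The reversed polynomial of \<open>C\<close> is a formal
  product of powers \<open>(1 - X ^ k) ^ b k\<close> with integers \<open>b k\<close>; taking logarithmic derivatives,
  \<open>T n\<close> is the sum of \<open>k * b k\<close> over the divisors \<open>k\<close> of \<open>n\<close>, so \<open>T\<close> satisfies the Dold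
  condition. If all \<open>l i\<close> agree, then \<open>d * U n = U 0 * T n\<close>, hence \<open>U\<close> almost satisfies it.

  Conversely, let \<open>c * U\<close> satisfy the Dold condition and let \<open>p\<close> be a prime not dividing \<open>c\<close>
  modulo which \<open>C\<close> is irreducible. Then \<open>U (p ^ i * n) = U n\<close> modulo \<open>p\<close>. In the field
  \<open>\<int>[x]/(p, C)\<close> the roots of \<open>C\<close> are the conjugates \<open>x ^ (p ^ i)\<close> for \<open>i < d\<close>, so the sum of the
  \<open>x ^ (p ^ i * n)\<close> is \<open>T n\<close>. The linear functional \<open>x ^ k \<mapsto> U k\<close> vanishes on multiples of \<open>C\<close>;
  applied to this identity it gives \<open>d * U n = U 0 * T n\<close> modulo \<open>p\<close>. As this holds for
  infinitely many \<open>p\<close>, it is an equality, and since the roots of \<open>C\<close> are distinct, all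
  \<open>l i\<close> agree.
\<close>

section \<open>Moebius inversion and the Dold condition\<close>

lemma moebius_prime_mult:
  assumes "prime p" "\<not> p dvd j" "j > 0"
  shows "moebius (p * j) = - moebius j"
proof -
  have cop: "algebraic_semidom_class.coprime p j" using assms by (simp add: prime_imp_coprime)
  have sq: "squarefree (p * j) \<longleftrightarrow> squarefree j"
    using cop assms(1) squarefree_mult_coprime[OF cop] squarefree_prime[of p]
      squarefree_multD(2) by blast
  have "prime_factors (p * j) = insert p (prime_factors j)"
    using assms by (simp add: prime_factors_product prime_prime_factors)
  moreover have "p \<notin> prime_factors j" using assms by auto
  ultimately have "card (prime_factors (p * j)) = Suc (card (prime_factors j))"
    by simp
  thus ?thesis using sq by (simp add: moebius_def)
qed

text \<open>Fix a prime \<open>p\<close> dividing \<open>n > 1\<close>. Divisors \<open>k\<close>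
  prime to \<open>p\<close> cancel against \<open>p * k\<close>; every other divisor is a multiple
  of \<open>p ^ 2\<close> and contributes 0.\<close>

lemma sum_moebius_divisors:
  assumes "n > 0"
  shows "(\<Sum>k | k dvd n. moebius k) = (if n = 1 then 1 else 0)"
proof (cases "n = 1")
  case True
  thus ?thesis by (simp add: moebius_def)
next
  case False
  then obtain p where p: "prime p" "p dvd n" using prime_factor_nat by blast
  have fin: "finite {k. k dvd n}" using assms by simp
  let ?A = "{k. k dvd n \<and> \<not> p dvd k}"
  have split: "{k. k dvd n} = ?A \<union> {k. k dvd n \<and> p dvd k}" by auto
  have img: "(*) p ` ?A \<subseteq> {k. k dvd n \<and> p dvd k}"
    using p by (auto intro!: divides_mult prime_imp_coprime)
  have zero: "moebius k = 0" if "k \<in> {k. k dvd n \<and> p dvd k} - (*) p ` ?A" for k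
  proof -
    from that obtain j where j: "k = p * j" by auto
    have "j dvd n" using that j by (auto dest: dvd_mult_right)
    hence "p dvd j" using that j by auto
    hence "p ^ 2 dvd k" unfolding j by (simp add: power2_eq_square)
    moreover have "\<not> is_unit p" using p by auto
    ultimately have "\<not> squarefree k" by (auto simp: squarefree_def)
    thus ?thesis by (simp add: moebius_def)
  qed
  have inj: "inj_on ((*) p) ?A" using p by (auto intro!: inj_onI simp: prime_gt_0_nat)
  have "(\<Sum>k | k dvd n \<and> p dvd k. moebius k) = (\<Sum>k\<in>(*) p ` ?A. moebius k)"
    using fin img zero by (intro sum.mono_neutral_right) (auto intro: finite_subset[OF _ fin])
  also have "\<dots> = (\<Sum>k\<in>?A. moebius (p * k))" by (simp add: sum.reindex[OF inj])
  also have "\<dots> = (\<Sum>k\<in>?A. - moebius k)"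
    using p assms by (intro sum.cong refl moebius_prime_mult) (auto intro: Nat.gr0I)
  also have "\<dots> = - (\<Sum>k\<in>?A. moebius k)" by (simp add: sum_negf)
  finally have "(\<Sum>k | k dvd n \<and> p dvd k. moebius k) = - (\<Sum>k\<in>?A. moebius k)" .
  moreover have "(\<Sum>k | k dvd n. moebius k) =
      (\<Sum>k\<in>?A. moebius k) + (\<Sum>k | k dvd n \<and> p dvd k. moebius k)"
    unfolding split using fin
    by (intro sum.union_disjoint) (auto intro: finite_subset[OF _ fin])
  ultimately show ?thesis using False by simp
qed

text \<open>Both sides run over the chains \<open>j dvd k dvd n\<close>; the right one writes
  \<open>k = j * i\<close>.\<close>

lemma sum_divisors_swap:
  fixes f :: "nat \<Rightarrow> nat \<Rightarrow> 'a :: comm_monoid_add"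
  assumes "n > 0"
  shows "(\<Sum>k | k dvd n. \<Sum>j | j dvd k. f k j)
       = (\<Sum>j | j dvd n. \<Sum>i | i dvd n div j. f (j * i) j)"
proof -
  have fin: "finite {k. k dvd m}" if "m dvd n" for m
    using assms that by (intro finite_divisors_nat) (auto intro: Nat.gr0I)
  have pos: "k > 0" if "k dvd n" for k using that assms by (auto intro: Nat.gr0I)
  have "(\<Sum>k | k dvd n. \<Sum>j | j dvd k. f k j)
      = (\<Sum>(k, j)\<in>(SIGMA k:{k. k dvd n}. {j. j dvd k}). f k j)"
    using fin by (intro sum.Sigma) auto
  also have "\<dots> = (\<Sum>(j, i)\<in>(SIGMA j:{j. j dvd n}. {i. i dvd n div j}). f (j * i) j)"
  proof -
    have "j * i dvd n" if "j dvd n" "i dvd n div j" for j i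
      using that assms by auto
    moreover have "k div j dvd n div j" if "k dvd n" "j dvd k" for k j
      using that dvd_trans[OF that(2,1)] by (simp add: div_dvd_iff_mult dvd_div_iff_mult)
    ultimately show ?thesis
      using dvd_trans pos
      by (intro sum.reindex_bij_witness[of _ "\<lambda>(j, i). (j * i, j)" "\<lambda>(k, j). (j, k div j)"])
        fastforce+
  qed
  also have "\<dots> = (\<Sum>j | j dvd n. \<Sum>i | i dvd n div j. f (j * i) j)"
    using fin by (intro sum.Sigma[symmetric]) auto
  finally show ?thesis .
qed

text \<open>The pairs summed over are those with \<open>k * j dvd n\<close>, a symmetric
  condition.\<close>

lemma sum_codivisors_swap:
  fixes f :: "nat \<Rightarrow> nat \<Rightarrow> 'a :: comm_monoid_add"
  assumes "n > 0"
  shows "(\<Sum>k | k dvd n. \<Sum>j | j dvd n div k. f k j)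
       = (\<Sum>j | j dvd n. \<Sum>k | k dvd n div j. f k j)"
proof -
  have pos: "k > 0" if "k dvd n" for k using that assms by (auto intro: Nat.gr0I)
  have fin: "finite {i. i dvd n div k}" if "k dvd n" for k
    using assms that by (intro finite_divisors_nat) (auto elim!: dvdE)
  have "(\<Sum>k | k dvd n. \<Sum>j | j dvd n div k. f k j)
      = (\<Sum>(k, j)\<in>(SIGMA k:{k. k dvd n}. {j. j dvd n div k}). f k j)"
    using fin assms by (intro sum.Sigma) auto
  also have "\<dots> = (\<Sum>(j, k)\<in>(SIGMA j:{j. j dvd n}. {k. k dvd n div j}). f k j)"
    by (rule sum.reindex_bij_witness[of _ prod.swap prod.swap])
      (use pos assms in \<open>auto dest: dvd_mult_left dvd_mult_right simp: dvd_div_iff_mult mult.commute\<close>)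
  also have "\<dots> = (\<Sum>j | j dvd n. \<Sum>k | k dvd n div j. f k j)"
    using fin assms by (intro sum.Sigma[symmetric]) auto
  finally show ?thesis .
qed

lemma moebius_inversion:
  fixes A :: "nat \<Rightarrow> int"
  assumes "n > 0"
  shows "(\<Sum>k | k dvd n. moebius k * (\<Sum>j | j dvd n div k. A j)) = A n"
proof -
  have "(\<Sum>k | k dvd n. moebius k * (\<Sum>j | j dvd n div k. A j))
      = (\<Sum>j | j dvd n. \<Sum>k | k dvd n div j. moebius k * A j)"
    unfolding sum_distrib_left by (rule sum_codivisors_swap[OF assms])
  also have "\<dots> = (\<Sum>j | j dvd n. if j = n then A n else 0)"
  proof (intro sum.cong refl)
    fix j assume "j \<in> {j. j dvd n}"
    then obtain i where i: "n = j * i" by auto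
    hence "i > 0" "j > 0" using assms by auto
    thus "(\<Sum>k | k dvd n div j. moebius k * A j) = (if j = n then A n else 0)"
      using sum_moebius_divisors[of i] i
      by (cases "i = 1") (simp_all flip: sum_distrib_right)
  qed
  also have "\<dots> = A n" using assms by (simp add: sum.delta)
  finally show ?thesis .
qed

lemma moebius_inversion':
  fixes A :: "nat \<Rightarrow> int"
  assumes "n > 0"
  shows "(\<Sum>k | k dvd n. \<Sum>j | j dvd k. moebius j * A (k div j)) = A n"
proof -
  have "(\<Sum>k | k dvd n. \<Sum>j | j dvd k. moebius j * A (k div j))
      = (\<Sum>j | j dvd n. \<Sum>i | i dvd n div j. moebius j * A i)"
    unfolding sum_divisors_swap[OF assms] using assms
    by (intro sum.cong refl) (auto elim!: dvdE)
  thus ?thesis using moebius_inversion[OF assms, of A] by (simp add: sum_distrib_left)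
qed

text \<open>Moebius inversion turns the sum into \<open>int n * b n\<close>. Only divisors of
  \<open>n\<close> enter the hypothesis, so \<open>b\<close> may be chosen separately for each
  \<open>n\<close>.\<close>

lemma dvd_moebius_sum:
  fixes A b :: "nat \<Rightarrow> int"
  assumes "n > 0" "\<And>m. m dvd n \<Longrightarrow> A m = (\<Sum>k | k dvd m. int k * b k)"
  shows "int n dvd (\<Sum>k | k dvd n. moebius k * A (n div k))"
proof -
  have "(\<Sum>k | k dvd n. moebius k * A (n div k))
      = (\<Sum>k | k dvd n. moebius k * (\<Sum>j | j dvd n div k. int j * b j))"
    by (intro sum.cong refl) (subst assms(2), auto intro: div_dvd_iff_mult)
  also have "\<dots> = int n * b n" by (rule moebius_inversion[OF assms(1)])
  finally show ?thesis by simp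
qed

lemma Dold_condition_divisor_sum:
  assumes "Dold_condition A"
  shows "\<exists>b. \<forall>n\<ge>1. A n = (\<Sum>k | k dvd n. int k * b k)"
proof -
  \<comment> \<open>The Dold condition makes this division exact.\<close>
  let ?b = "\<lambda>n. (\<Sum>k | k dvd n. moebius k * A (n div k)) div int n"
  show ?thesis
  proof (intro exI[of _ ?b] allI impI)
    fix n :: nat assume n: "n \<ge> 1"
    have "(\<Sum>k | k dvd n. int k * ?b k) = (\<Sum>k | k dvd n. \<Sum>j | j dvd k. moebius j * A (k div j))"
    proof (intro sum.cong refl)
      fix k assume "k \<in> {k. k dvd n}"
      hence "k \<ge> 1" using n by (auto intro: Nat.gr0I simp: Suc_le_eq)
      thus "int k * ?b k = (\<Sum>j | j dvd k. moebius j * A (k div j))"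
        using assms unfolding Dold_condition_def by (intro dvd_mult_div_cancel) auto
    qed
    thus "A n = (\<Sum>k | k dvd n. int k * ?b k)" using moebius_inversion'[of n A] n by simp
  qed
qed

lemma Dold_condition_cmult:
  assumes "Dold_condition A"
  shows "Dold_condition (\<lambda>n. c * A n)"
  using assms unfolding Dold_condition_def
  by (simp add: mult.left_commute[of _ c] flip: sum_distrib_left)

text \<open>In the difference of the two divisor sums only divisors of \<open>p * m\<close> that do
  not divide \<open>m\<close> remain, and each of these is a multiple of \<open>p\<close>.\<close>

lemma Dold_condition_prime_cong:
  assumes "Dold_condition A" "prime p" "m \<ge> 1"
  shows "int p dvd A (p * m) - A m"
proof -
  from assms(1) obtain b where b: "\<And>n. n \<ge> 1 \<Longrightarrow> A n = (\<Sum>k | k dvd n. int k * b k)"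
    using Dold_condition_divisor_sum by blast
  have pm: "p * m \<ge> 1" using assms prime_gt_0_nat[of p] by (simp add: Suc_le_eq)
  have fin: "finite {k. k dvd p * m}" using pm by simp
  have "A (p * m) - A m = (\<Sum>k\<in>{k. k dvd p * m} - {k. k dvd m}. int k * b k)"
    using b[OF pm] b[OF assms(3)] fin by (subst sum_diff) auto
  moreover have "int p dvd int k * b k" if "k \<in> {k. k dvd p * m} - {k. k dvd m}" for k
  proof -
    have "p dvd k"
    proof (rule ccontr)
      assume "\<not> p dvd k"
      hence "algebraic_semidom_class.coprime k p"
        using prime_imp_coprime[OF assms(2)] by (simp add: ac_simps)
      thus False using that by (simp add: coprime_dvd_mult_right_iff)
    qed
    thus ?thesis by simp
  qed
  ultimately show ?thesis by (simp only: dvd_sum)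
qed

lemma Dold_condition_cong:
  assumes "\<And>n. n \<ge> 1 \<Longrightarrow> A n = B n"
  shows "Dold_condition A \<longleftrightarrow> Dold_condition B"
proof -
  have "A (n div k) = B (n div k)" if "n \<ge> 1" "k dvd n" for n k
    using that assms by (auto elim!: dvdE simp: Suc_le_eq)
  hence "(\<Sum>k | k dvd n. moebius k * A (n div k)) = (\<Sum>k | k dvd n. moebius k * B (n div k))"
    if "n \<ge> 1" for n using that by (intro sum.cong) auto
  thus ?thesis unfolding Dold_condition_def by simp
qed

lemma Dold_condition_prime_power_cong:
  assumes "Dold_condition A" "prime p" "m \<ge> 1"
  shows "int p dvd A (p ^ i * m) - A m"
proof (induction i)
  case (Suc i)
  have "p ^ i * m \<ge> 1" using assms prime_gt_0_nat[of p] by (simp add: Suc_le_eq)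
  from dvd_add[OF Dold_condition_prime_cong[OF assms(1,2) this] Suc] show ?case
    by (simp add: mult.assoc)
qed simp

section \<open>Power sums and logarithmic derivatives\<close>

no_notation vec_index (infixl "$" 100)
unbundle fps_syntax


text \<open>That is, \<open>S = - X F' / F\<close>: for \<open>F\<close> the product of the \<open>1 - a i * X\<close>, the coefficients of \<open>S\<close>
  in positive degree are the power sums of the \<open>a i\<close>.\<close>
definition power_sum_fps :: "'a::comm_ring_1 fps \<Rightarrow> 'a fps \<Rightarrow> bool" where
  "power_sum_fps F S \<longleftrightarrow> fps_X * fps_deriv F = - (F * S)"

lemma power_sum_fps_1: "power_sum_fps 1 0"
  by (simp add: power_sum_fps_def)

text \<open>Logarithmic derivatives turn products into sums.\<close>

lemma power_sum_fps_mult: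
  assumes "power_sum_fps F S" "power_sum_fps G R"
  shows "power_sum_fps (F * G) (S + R)"
proof -
  have "fps_X * fps_deriv (F * G) = F * (fps_X * fps_deriv G) + (fps_X * fps_deriv F) * G"
    by (simp add: algebra_simps)
  also have "\<dots> = - (F * G * (S + R))"
    using assms by (simp add: power_sum_fps_def algebra_simps)
  finally show ?thesis by (simp add: power_sum_fps_def)
qed

lemma power_sum_fps_prod:
  assumes "\<And>i. i \<in> A \<Longrightarrow> power_sum_fps (F i) (S i)"
  shows "power_sum_fps (\<Prod>i\<in>A. F i) (\<Sum>i\<in>A. S i)"
  using assms
  by (induction A rule: infinite_finite_induct)
    (auto simp: power_sum_fps_1 intro!: power_sum_fps_mult)

lemma power_sum_fps_power:
  assumes "power_sum_fps F S"
  shows "power_sum_fps (F ^ n) (of_nat n * S)"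
  using power_sum_fps_prod[of "{..<n}" "\<lambda>_. F" "\<lambda>_. S"] assms by simp

lemma power_sum_fps_inverse:
  assumes "power_sum_fps F S" "F * G = 1"
  shows "power_sum_fps G (- S)"
proof -
  have "0 = fps_X * fps_deriv (F * G)" by (simp add: assms(2))
  also have "\<dots> = F * (fps_X * fps_deriv G) + (fps_X * fps_deriv F) * G"
    by (simp add: algebra_simps)
  also have "\<dots> = F * (fps_X * fps_deriv G) - F * G * S"
    using assms(1) by (simp add: power_sum_fps_def mult_ac)
  finally have "F * (fps_X * fps_deriv G) = S" by (simp add: assms(2))
  hence "G * (F * (fps_X * fps_deriv G)) = G * S" by simp
  hence "(F * G) * (fps_X * fps_deriv G) = G * S" by (simp only: mult_ac)
  thus ?thesis by (simp add: power_sum_fps_def assms(2))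
qed

lemma power_sum_fps_exists:
  assumes "F $ 0 = 1"
  shows "\<exists>S. power_sum_fps F S"
proof -
  obtain G where "F * G = 1" using fps_right_inverse[of F 1] assms by auto
  hence "fps_X * fps_deriv F = - (F * (- (G * (fps_X * fps_deriv F))))"
    by (simp flip: mult.assoc)
  thus ?thesis unfolding power_sum_fps_def by blast
qed

text \<open>Newton's identities, from comparing coefficients. For \<open>n > 0\<close> the right
  side involves only earlier coefficients of \<open>S\<close>, so \<open>F\<close> determines
  \<open>S\<close>.\<close>

lemma power_sum_fps_nth:
  assumes "power_sum_fps F S" "F $ 0 = 1"
  shows "S $ n = - (of_nat n * F $ n) - (\<Sum>k=1..n. F $ k * S $ (n - k))"
proof -
  have "(fps_X * fps_deriv F) $ n = of_nat n * F $ n"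
    by (cases n) (auto simp: fps_X_mult_nth)
  moreover have "(F * S) $ n = S $ n + (\<Sum>k=1..n. F $ k * S $ (n - k))"
    by (simp add: fps_mult_nth sum.atLeast_Suc_atMost assms(2))
  ultimately have "of_nat n * F $ n = - (S $ n + (\<Sum>k=1..n. F $ k * S $ (n - k)))"
    using assms(1) unfolding power_sum_fps_def by (metis fps_neg_nth)
  thus ?thesis by simp
qed

lemma power_sum_fps_linear:
  "power_sum_fps (1 - fps_const a * fps_X) (Abs_fps (\<lambda>n. if n = 0 then 0 else a ^ n))"
  unfolding power_sum_fps_def
proof (rule fps_ext)
  fix n
  show "(fps_X * fps_deriv (1 - fps_const a * fps_X)) $ n =
    (- ((1 - fps_const a * fps_X) * Abs_fps (\<lambda>n. if n = 0 then 0 else a ^ n))) $ n"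
    by (cases n; cases "n - 1") (auto simp: algebra_simps mult.assoc fps_X_mult_nth)
qed

text \<open>This is the expansion of \<open>m X^m / (1 - X^m)\<close>.\<close>

lemma power_sum_fps_one_minus_X_power:
  assumes "m > 0"
  shows "power_sum_fps (1 - fps_X ^ m)
    (Abs_fps (\<lambda>n. if m dvd n \<and> n > 0 then of_nat m else 0) :: 'a::comm_ring_1 fps)"
  unfolding power_sum_fps_def
proof (rule fps_ext)
  fix n
  let ?S = "Abs_fps (\<lambda>n. if m dvd n \<and> n > 0 then of_nat m else 0) :: 'a fps"
  have L: "(fps_X * fps_deriv (1 - fps_X ^ m)) $ n = (if n = m then - of_nat m else (0::'a))"
    using assms by (cases n) (auto simp: fps_X_mult_nth fps_X_power_nth)
  have "((1 - fps_X ^ m) * ?S) $ n = ?S $ n - (if n < m then 0 else ?S $ (n - m))"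
    by (simp add: algebra_simps fps_X_power_mult_nth)
  also have "\<dots> = (if n = m then of_nat m else 0)"
  proof (cases "n < m")
    case True
    thus ?thesis by (auto dest: dvd_imp_le)
  next
    case False
    then obtain k where "n = m + k" by (metis le_add_diff_inverse not_less)
    thus ?thesis using assms by auto
  qed
  finally show "(fps_X * fps_deriv (1 - fps_X ^ m)) $ n = (- ((1 - fps_X ^ m) * ?S)) $ n"
    using L by simp
qed

text \<open>The predicate \<open>J\<close> is membership in an ideal. Newton's identities need no
  division, so congruence modulo \<open>J\<close> passes from \<open>F\<close> to \<open>S\<close>
  by induction.\<close>

lemma power_sum_fps_cong_mod:
  fixes F S :: "'a::comm_ring_1 fps" and F' S' :: "int fps"
  assumes J: "J 0" "\<And>x y. J x \<Longrightarrow> J y \<Longrightarrow> J (x + y)" "\<And>a x. J x \<Longrightarrow> J (a * x)"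
    and F: "F $ 0 = 1" "F' $ 0 = 1" "\<And>n. J (F $ n - of_int (F' $ n))"
    and S: "power_sum_fps F S" "power_sum_fps F' S'"
  shows "J (S $ n - of_int (S' $ n))"
proof (induction n rule: less_induct)
  case (less n)
  have Jsum: "J (\<Sum>k\<in>A. f k)" if "\<And>k. k \<in> A \<Longrightarrow> J (f k)" for A and f :: "nat \<Rightarrow> 'a"
    using that by (induction A rule: infinite_finite_induct) (auto intro: J)
  have "S $ n - of_int (S' $ n) = (- of_nat n) * (F $ n - of_int (F' $ n))
     + (-1) * (\<Sum>k=1..n. S $ (n - k) * (F $ k - of_int (F' $ k))
                 + of_int (F' $ k) * (S $ (n - k) - of_int (S' $ (n - k))))"
    by (subst power_sum_fps_nth[OF S(1) F(1)], subst power_sum_fps_nth[OF S(2) F(2)])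
      (simp add: algebra_simps sum.distrib sum_subtractf)
  also have "J \<dots>" using less.IH F(3) by (intro J Jsum) auto
  finally show ?case .
qed

lemma power_sum_fps_eq_0_below:
  assumes "power_sum_fps F S" "F $ 0 = 1" "\<And>k. 0 < k \<Longrightarrow> k \<le> N \<Longrightarrow> F $ k = 0" "n \<le> N"
  shows "S $ n = 0"
  by (subst power_sum_fps_nth[OF assms(1,2)]) (use assms(3,4) in \<open>cases "n = 0"; auto\<close>)

text \<open>For \<open>m > 0\<close> this means \<open>F = 1 + c X^m\<close> modulo
  \<open>X^(m+1)\<close>; for \<open>m = 0\<close> it says only that the constant coefficient is
  1.\<close>

definition fps_leading :: "nat \<Rightarrow> 'a::comm_ring_1 \<Rightarrow> 'a fps \<Rightarrow> bool" where
  "fps_leading m c F \<longleftrightarrow> (\<forall>k\<le>m. F $ k = (if k = 0 then 1 else if k = m then c else 0))"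

lemma fps_leading_mult:
  assumes "fps_leading m a F" "fps_leading m b G" "m > 0"
  shows "fps_leading m (a + b) (F * G)"
  unfolding fps_leading_def
proof (intro allI impI)
  fix k assume k: "k \<le> m"
  have "(F * G) $ k = (\<Sum>i=0..k. (if i = 0 then G $ k else 0) + (if i = k \<and> k > 0 then F $ k else 0))"
    unfolding fps_mult_nth using assms k
    by (intro sum.cong refl) (auto simp: fps_leading_def)
  also have "\<dots> = G $ k + (if k > 0 then F $ k else 0)"
    by (auto simp: sum.distrib sum.delta)
  finally show "(F * G) $ k = (if k = 0 then 1 else if k = m then a + b else 0)"
    using assms k by (auto simp: fps_leading_def)
qed

lemma fps_leading_power:
  assumes "fps_leading m a F" "m > 0"
  shows "fps_leading m (of_nat n * a) (F ^ n)"
proof (induction n)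
  case 0
  show ?case by (auto simp: fps_leading_def)
next
  case (Suc n)
  show ?case using fps_leading_mult[OF assms(1) Suc assms(2)] by (simp add: algebra_simps)
qed

text \<open>The witness is \<open>(1 - X^m)^c\<close>; for negative \<open>c\<close> it is a power
  of the inverse series \<open>H\<close>.\<close>

lemma exists_fps_leading:
  assumes "m > 0"
  shows "\<exists>G::int fps. fps_leading m (- c) G \<and>
    power_sum_fps G (Abs_fps (\<lambda>n. if m dvd n \<and> n > 0 then c * int m else 0))"
proof -
  define E H :: "int fps" where "E = 1 - fps_X ^ m" and "H = Abs_fps (\<lambda>n. if m dvd n then 1 else 0)"
  let ?S = "Abs_fps (\<lambda>n. if m dvd n \<and> n > 0 then int m else 0)"
  have E: "fps_leading m (- 1) E" "power_sum_fps E ?S"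
    using assms power_sum_fps_one_minus_X_power[OF assms, where 'a = int]
    by (auto simp: fps_leading_def E_def)
  have "E * H = 1"
  proof (rule fps_ext)
    fix n
    have "(E * H) $ n = H $ n - (if n < m then 0 else H $ (n - m))"
      by (simp add: E_def left_diff_distrib fps_X_power_mult_nth)
    also have "\<dots> = 1 $ n"
      using assms by (auto simp: H_def dvd_minus_self dest: dvd_imp_le)
    finally show "(E * H) $ n = 1 $ n" .
  qed
  hence H: "fps_leading m 1 H" "power_sum_fps H (- ?S)"
    using power_sum_fps_inverse[OF E(2)] assms
    by (auto simp: fps_leading_def H_def dest: dvd_imp_le)
  show ?thesis
  proof (cases "c \<ge> 0")
    case True
    have "of_nat (nat c) * ?S = Abs_fps (\<lambda>n. if m dvd n \<and> n > 0 then c * int m else 0)"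
      using True by (intro fps_ext) (simp add: fps_mult_of_nat_nth)
    thus ?thesis
      using fps_leading_power[OF E(1) assms, of "nat c"] power_sum_fps_power[OF E(2), of "nat c"] True
      by (intro exI[of _ "E ^ nat c"]) auto
  next
    case False
    have "of_nat (nat (- c)) * - ?S = Abs_fps (\<lambda>n. if m dvd n \<and> n > 0 then c * int m else 0)"
      using False by (intro fps_ext) (simp add: fps_mult_of_nat_nth)
    thus ?thesis
      using fps_leading_power[OF H(1) assms, of "nat (- c)"]
        power_sum_fps_power[OF H(2), of "nat (- c)"] False
      by (intro exI[of _ "H ^ nat (- c)"]) auto
  qed
qed

text \<open>Factors \<open>(1 - X^k)^(b k)\<close> are stripped from \<open>F\<close> for
  \<open>k = 1, 2, ...\<close>. After \<open>N\<close> of them the rest \<open>G\<close> is 1 modulo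
  \<open>X^(N+1)\<close>, so its power sums \<open>R\<close> vanish up to degree \<open>N\<close>,
  and \<open>S\<close> is there the divisor sum of \<open>k * b k\<close>.\<close>

lemma power_sum_fps_int_Dold:
  fixes F S :: "int fps"
  assumes "power_sum_fps F S" "F $ 0 = 1"
  shows "Dold_condition (\<lambda>n. S $ n)"
proof -
  have "\<exists>b G R. power_sum_fps G R \<and> fps_leading N 0 G \<and>
      (\<forall>n>0. R $ n = S $ n - (\<Sum>k | k dvd n \<and> k \<le> N. int k * b k))" for N
  proof (induction N)
    case 0
    show ?case using assms
      by (intro exI[of _ "\<lambda>_. 0"] exI[of _ F] exI[of _ S]) (auto simp: fps_leading_def)
  next
    case (Suc N)
    then obtain b G R where IH: "power_sum_fps G R" "fps_leading N 0 G"
      "\<And>n. n > 0 \<Longrightarrow> R $ n = S $ n - (\<Sum>k | k dvd n \<and> k \<le> N. int k * b k)" by blast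
    \<comment> \<open>Multiplying by \<open>(1 - X^m)^c\<close> clears the coefficient
      \<open>c\<close>, so \<open>F\<close> itself contains this factor with exponent
      \<open>b m = - c\<close>.\<close>
    define m c where "m = Suc N" and "c = G $ m"
    let ?R = "Abs_fps (\<lambda>n. if m dvd n \<and> n > 0 then c * int m else 0)"
    obtain H where H: "fps_leading m (- c) H" "power_sum_fps H ?R"
      using exists_fps_leading[of m c] by (auto simp: m_def)
    have "fps_leading m c G"
      using IH(2) by (auto simp: fps_leading_def c_def m_def le_Suc_eq)
    from fps_leading_mult[OF this H(1)] have 1: "fps_leading m 0 (G * H)" by (simp add: m_def)
    have "(R + ?R) $ n = S $ n - (\<Sum>k | k dvd n \<and> k \<le> m. int k * (b(m := - c)) k)" if "n > 0" for n
    proof -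
      have fin: "finite {k. k dvd n \<and> k \<le> N}" by simp
      have "{k. k dvd n \<and> k \<le> m} = {k. k dvd n \<and> k \<le> N} \<union> (if m dvd n then {m} else {})"
        by (auto simp: m_def le_Suc_eq)
      hence "(\<Sum>k | k dvd n \<and> k \<le> m. int k * (b(m := - c)) k) =
          (\<Sum>k | k dvd n \<and> k \<le> N. int k * (b(m := - c)) k) + (if m dvd n then - (c * int m) else 0)"
        using fin by (auto simp: m_def)
      also have "(\<Sum>k | k dvd n \<and> k \<le> N. int k * (b(m := - c)) k) =
          (\<Sum>k | k dvd n \<and> k \<le> N. int k * b k)"
        by (intro sum.cong) (auto simp: m_def)
      finally show ?thesis using IH(3)[OF that] that by simp
    qed
    thus ?case using 1 power_sum_fps_mult[OF IH(1) H(2)] unfolding m_def by blast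
  qed note factor = this
  show ?thesis unfolding Dold_condition_def
  proof (intro allI impI)
    fix n :: nat assume n: "n \<ge> 1"
    obtain b G R where G: "power_sum_fps G R" "fps_leading n 0 G"
      "\<And>m. m > 0 \<Longrightarrow> R $ m = S $ m - (\<Sum>k | k dvd m \<and> k \<le> n. int k * b k)"
      using factor by blast
    show "int n dvd (\<Sum>k | k dvd n. moebius k * S $ (n div k))"
    proof (rule dvd_moebius_sum)
      fix m assume m: "m dvd n"
      hence m': "0 < m" "m \<le> n" using n by (auto intro: Nat.gr0I dvd_imp_le)
      have "R $ m = 0"
        by (rule power_sum_fps_eq_0_below[OF G(1), of n]) (use G(2) m' in \<open>auto simp: fps_leading_def\<close>)
      moreover have "{k. k dvd m \<and> k \<le> n} = {k. k dvd m}"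
        using m' dvd_imp_le[OF _ m'(1)] le_trans by blast
      ultimately show "S $ m = (\<Sum>k | k dvd m. int k * b k)" using G(3)[OF m'(1)] by simp
    qed (use n in auto)
  qed
qed

text \<open>Reversal is multiplicative and sends \<open>X - a\<close> to
  \<open>1 - a X\<close>.\<close>

lemma power_sum_fps_roots:
  fixes a :: "nat \<Rightarrow> 'a::idom"
  shows "power_sum_fps (fps_of_poly (reflect_poly (\<Prod>i<d. [:- a i, 1:])))
    (\<Sum>i<d. Abs_fps (\<lambda>n. if n = 0 then 0 else a i ^ n))"
proof -
  have 1: "reflect_poly [:- c, 1:] = [:1, - c:]" for c :: 'a
    by (rule poly_eqI) (auto simp: coeff_reflect_poly coeff_pCons split: nat.splits)
  have 2: "fps_of_poly [:1, - c:] = 1 - fps_const c * fps_X" for c :: 'a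
    by (simp add: fps_of_poly_pCons mult.commute)
  show ?thesis
    unfolding reflect_poly_prod fps_of_poly_prod 1 2
    by (intro power_sum_fps_prod power_sum_fps_linear)
qed

text \<open>Used twice: with the zero ideal for the complex roots of \<open>C\<close>, and with the
  ideal \<open>(p, C)\<close> for the conjugates of \<open>x\<close>.\<close>

lemma power_sum_cong_mod:
  fixes a :: "nat \<Rightarrow> 'a::idom" and C :: "int poly"
  assumes J: "J 0" "\<And>x y. J x \<Longrightarrow> J y \<Longrightarrow> J (x + y)" "\<And>a x. J x \<Longrightarrow> J (a * x)"
    and C: "lead_coeff C = 1"
    and cong: "\<And>n. J (coeff (\<Prod>i<degree C. [:- a i, 1:]) n - of_int (coeff C n))"
    and T: "power_sum_fps (fps_of_poly (reflect_poly C)) T" and "n > 0"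
  shows "J ((\<Sum>i<degree C. a i ^ n) - of_int (T $ n))"
proof -
  define P where "P = (\<Prod>i<degree C. [:- a i, 1:])"
  have deg: "degree P = degree C" by (simp add: P_def degree_prod_eq_sum_degree)
  have lead: "lead_coeff P = 1" by (simp add: P_def lead_coeff_prod)
  have "J ((\<Sum>i<degree C. Abs_fps (\<lambda>n. if n = 0 then 0 else a i ^ n)) $ n - of_int (T $ n))"
    by (rule power_sum_fps_cong_mod[where J = J, OF J _ _ _ power_sum_fps_roots T], fold P_def)
      (use lead C cong[folded P_def] in \<open>auto simp: coeff_reflect_poly deg J(1)\<close>)
  thus ?thesis using \<open>n > 0\<close> by (simp add: fps_sum_nth)
qed

section \<open>The ideal generated by a prime and a monic polynomial\<close>

text \<open>Membership in the ideal \<open>(m, C)\<close> of integer polynomials; congruences modulo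
  it replace computation in the residue ring.\<close>

definition mod_ideal :: "int \<Rightarrow> int poly \<Rightarrow> int poly \<Rightarrow> bool" where
  "mod_ideal m C f \<longleftrightarrow> (\<exists>a b. f = smult m a + C * b)"

lemma mod_ideal_0 [simp]: "mod_ideal m C 0"
  unfolding mod_ideal_def by (intro exI[of _ 0]) simp

lemma mod_ideal_add: "mod_ideal m C f \<Longrightarrow> mod_ideal m C g \<Longrightarrow> mod_ideal m C (f + g)"
  unfolding mod_ideal_def
  by (elim exE, rename_tac a a' b b', rule_tac x = "a + a'" in exI, rule_tac x = "b + b'" in exI)
    (simp add: algebra_simps smult_add_right)

lemma mod_ideal_mult: "mod_ideal m C f \<Longrightarrow> mod_ideal m C (g * f)"
  unfolding mod_ideal_def
  by (elim exE, rename_tac a b, rule_tac x = "g * a" in exI, rule_tac x = "g * b" in exI)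
    (simp add: algebra_simps)

lemma mod_ideal_minus: "mod_ideal m C f \<Longrightarrow> mod_ideal m C (- f)"
  using mod_ideal_mult[of m C f "-1"] by simp

lemma mod_ideal_diff: "mod_ideal m C f \<Longrightarrow> mod_ideal m C g \<Longrightarrow> mod_ideal m C (f - g)"
  using mod_ideal_add[of m C f "- g"] mod_ideal_minus by simp

lemma mod_ideal_trans: "mod_ideal m C (f - g) \<Longrightarrow> mod_ideal m C (g - h) \<Longrightarrow> mod_ideal m C (f - h)"
  using mod_ideal_add[of m C "f - g" "g - h"] by simp

lemma mod_ideal_sum: "(\<And>i. i \<in> A \<Longrightarrow> mod_ideal m C (f i)) \<Longrightarrow> mod_ideal m C (\<Sum>i\<in>A. f i)"
  by (induction A rule: infinite_finite_induct) (auto intro: mod_ideal_add)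

lemma mod_ideal_smult_modulus [simp]: "mod_ideal m C (smult m a)"
  unfolding mod_ideal_def by (intro exI[of _ a] exI[of _ 0]) simp

lemma mod_ideal_multiple [simp]: "mod_ideal m C (C * b)"
  unfolding mod_ideal_def by (intro exI[of _ 0] exI[of _ b]) simp

lemma mod_ideal_diff_mult:
  assumes "mod_ideal m C (f - f')" "mod_ideal m C (g - g')"
  shows "mod_ideal m C (f * g - f' * g')"
proof -
  have "f * g - f' * g' = g * (f - f') + f' * (g - g')" by (simp add: algebra_simps)
  thus ?thesis using assms by (auto intro: mod_ideal_add mod_ideal_mult)
qed

lemma mod_ideal_diff_prod:
  "(\<And>i. i \<in> A \<Longrightarrow> mod_ideal m C (f i - g i)) \<Longrightarrow> mod_ideal m C (prod f A - prod g A)"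
  by (induction A rule: infinite_finite_induct) (auto intro: mod_ideal_diff_mult)

lemma const_dvd_iff_smult: "[:m:] dvd (f :: int poly) \<longleftrightarrow> (\<exists>a. f = smult m a)"
  by (auto simp: dvd_def)

lemma monic_division:
  fixes f g :: "'a::idom poly"
  assumes "lead_coeff g = 1"
  obtains q r where "f = g * q + r" "r = 0 \<or> degree r < degree g"
proof -
  obtain q r where qr: "pseudo_divmod f g = (q, r)" by force
  have "g \<noteq> 0" using assms by auto
  from pseudo_divmod[OF this qr] show ?thesis using assms that by simp
qed

lemma (in poly_mod) not_dvd_lead_coeff_Mp:
  assumes "Mp f \<noteq> 0"
  shows "\<not> m dvd lead_coeff (Mp f)"
proof
  assume "m dvd lead_coeff (Mp f)"
  hence "m dvd coeff f (degree (Mp f))" by (simp add: Mp_coeff M_def dvd_mod_iff)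
  hence "lead_coeff (Mp f) = 0" unfolding Mp_coeff M_def by simp
  thus False using assms by simp
qed

text \<open>Write \<open>f = m a + C b\<close> with \<open>b\<close> reduced modulo
  \<open>m\<close>. If \<open>b\<close> were nonzero, its leading coefficient would survive modulo
  \<open>m\<close> in degree \<open>degree C + degree b\<close>, too high for
  \<open>f\<close>.\<close>

lemma mod_ideal_degree_less:
  assumes "lead_coeff C = 1" "mod_ideal m C f" "degree f < degree C \<or> f = 0"
  shows "[:m:] dvd f"
proof -
  interpret poly_mod m .
  from assms(2) obtain a b where f: "f = smult m a + C * b" unfolding mod_ideal_def by blast
  have "[:m:] dvd b - Mp b" by (auto simp: const_poly_dvd_iff Mp_coeff M_def mod_eq_dvd_iff[symmetric])
  then obtain b' where b': "b = Mp b + smult m b'"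
    unfolding const_dvd_iff_smult by (metis diff_add_cancel add.commute)
  have f': "f = smult m (a + C * b') + C * Mp b"
    unfolding f by (subst b') (simp add: algebra_simps smult_add_right)
  have "Mp b = 0"
  proof (rule ccontr)
    assume nz: "Mp b \<noteq> 0"
    let ?n = "degree C + degree (Mp b)"
    have "coeff f ?n = 0" using assms(3) by (auto intro: coeff_eq_0)
    moreover have "coeff f ?n = m * coeff (a + C * b') ?n + lead_coeff (Mp b)"
      unfolding f' using assms(1) coeff_mult_degree_sum[of C "Mp b"]
      by (simp only: coeff_add coeff_smult mult_1)
    ultimately have "m dvd lead_coeff (Mp b)"
      by (metis add.commute dvd_0_right dvd_add_right_iff dvd_triv_left)
    thus False using not_dvd_lead_coeff_Mp nz by blast
  qed
  thus ?thesis unfolding f' by (auto simp: const_dvd_iff_smult)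
qed

locale irreducible_modulo =
  fixes p :: nat and C :: "int poly"
  assumes p: "prime p" and monic: "lead_coeff C = 1"
    and irr: "poly_mod.irreducible_m (int p) C" and deg: "degree C > 0"
begin

abbreviation I where "I \<equiv> mod_ideal (int p) C"

lemma eq_mod_dvd: "poly_mod.Mp (int p) f = poly_mod.Mp (int p) g \<longleftrightarrow> [:int p:] dvd f - g"
  by (simp add: poly_eq_iff poly_mod.Mp_coeff poly_mod.M_def const_poly_dvd_iff mod_eq_dvd_iff)

lemma I_const_dvd: "[:int p:] dvd f \<Longrightarrow> I f"
  by (auto simp: const_dvd_iff_smult)

lemma I_1: "\<not> I 1"
proof
  assume "I 1"
  from mod_ideal_degree_less[OF monic this] have "[:int p:] dvd 1" using deg by simp
  hence "int p dvd coeff 1 0" unfolding const_poly_dvd_iff by blast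
  thus False using p by auto
qed

text \<open>Suppose neither factor lies in \<open>I\<close>, and let \<open>h\<close> be a monic
  element of least degree in the ideal \<open>J\<close> generated by \<open>I\<close> and
  \<open>f\<close>. It divides \<open>C\<close> modulo \<open>p\<close>, so irreducibility leaves
  two cases: \<open>h\<close> is a unit, whence \<open>1\<close> is in \<open>J\<close> and
  \<open>g\<close> in \<open>I\<close>; or the cofactor is a unit, whence \<open>h\<close> and then
  \<open>f\<close> are in \<open>I\<close>.\<close>

lemma I_prime:
  assumes fg: "I (f * g)"
  shows "I f \<or> I g"
proof (rule ccontr)
  assume "\<not> (I f \<or> I g)"
  hence nf: "\<not> I f" and ng: "\<not> I g" by auto
  define J where "J = (\<lambda>h. \<exists>a. I (h - a * f))"
  have J_I: "J h" if "I h" for h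
    using that unfolding J_def by (intro exI[of _ 0]) simp
  have J_f: "J f" unfolding J_def by (intro exI[of _ 1]) simp
  have J_mult: "J (k * h)" if "J h" for h k
  proof -
    from that obtain a where "I (h - a * f)" unfolding J_def by blast
    from mod_ideal_mult[OF this, of k] show ?thesis
      unfolding J_def by (intro exI[of _ "k * a"]) (simp add: algebra_simps)
  qed
  have J_add: "J (h + k)" if "J h" "J k" for h k
  proof -
    from that obtain a b where "I (h - a * f)" "I (k - b * f)" unfolding J_def by blast
    from mod_ideal_add[OF this] show ?thesis
      unfolding J_def by (intro exI[of _ "a + b"]) (simp add: algebra_simps)
  qed
  have J_diff: "J (h - k)" if "J h" "J k" for h k
    using J_add[OF that(1) J_mult[OF that(2), of "-1"]] by simp
  have I_C: "I C" using mod_ideal_multiple[of "int p" C 1] by simp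
  \<comment> \<open>Only monic elements compete, since division by them stays within integer
    polynomials.\<close>
  define P where "P = (\<lambda>n. \<exists>h. J h \<and> lead_coeff h = 1 \<and> degree h = n)"
  have "P (degree C)" unfolding P_def using monic J_I[OF I_C] by blast
  hence "P (LEAST n. P n)" by (rule LeastI)
  then obtain h where h: "J h" "lead_coeff h = 1" "degree h = (LEAST n. P n)"
    unfolding P_def by blast
  have small: "[:int p:] dvd r" if r: "J r" "r = 0 \<or> degree r < degree h" for r
  proof (rule ccontr)
    interpret poly_mod "int p" .
    assume nd: "\<not> [:int p:] dvd r"
    hence nz: "Mp r \<noteq> 0" using eq_mod_dvd[of r 0] by simp
    let ?n = "degree (Mp r)" and ?a = "lead_coeff (Mp r)"
    have "[:int p:] dvd Mp r - r" unfolding eq_mod_dvd[symmetric] by simp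
    from J_add[OF J_I[OF I_const_dvd[OF this]] r(1)] have JM: "J (Mp r)" by simp
    have "\<not> int p dvd ?a" using nz by (rule not_dvd_lead_coeff_Mp)
    hence "algebraic_semidom_class.coprime ?a (int p)"
      using p prime_imp_coprime[of "int p" ?a] by (simp add: ac_simps)
    then obtain b v where "b * ?a + v * int p = 1" using bezout_int[of ?a "int p"] by auto
    then obtain k where k: "?a * b = 1 + int p * k" by (intro that[of "- v"]) (simp add: algebra_simps)
    \<comment> \<open>Here \<open>b\<close> inverts the leading coefficient modulo \<open>p\<close>;
      subtracting the multiple of \<open>p\<close> makes it exactly 1, so that \<open>?s\<close>
      competes with \<open>h\<close>.\<close>
    let ?s = "smult b (Mp r) - smult (int p) (monom k ?n)"
    have "J ?s" using J_diff[OF J_mult[OF JM, of "[:b:]"] J_I[OF mod_ideal_smult_modulus]] by simp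
    moreover have c1: "coeff ?s ?n = 1" using k by (simp add: mult.commute)
    moreover have le: "degree ?s \<le> ?n"
      by (intro degree_diff_le degree_smult_le order.trans[OF degree_smult_le]) (auto simp: degree_monom_le)
    moreover have "degree ?s = ?n" using c1 le le_degree[of ?s ?n] by simp
    ultimately have "P ?n" unfolding P_def by metis
    hence "degree h \<le> ?n" unfolding h(3) by (rule Least_le)
    moreover have "?n \<le> degree r" by (rule degree_m_le)
    ultimately show False using r(2) nd by auto
  qed
  obtain q r where qr: "C = h * q + r" "r = 0 \<or> degree r < degree h"
    using monic_division[OF h(2)] by blast
  have "J r" using J_diff[OF J_I[OF I_C] J_mult[OF h(1), of q]] qr(1) by (simp add: algebra_simps)
  with small qr have r: "[:int p:] dvd r" by blast
  hence "poly_mod.Mp (int p) C = poly_mod.Mp (int p) (h * q)"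
    unfolding eq_mod_dvd using qr(1) by simp
  hence "poly_mod.dvdm (int p) h 1 \<or> poly_mod.dvdm (int p) q 1"
    using irr unfolding poly_mod.irreducible_m_def by blast
  thus False
  proof
    assume "poly_mod.dvdm (int p) h 1"
    then obtain k where "[:int p:] dvd 1 - h * k" unfolding poly_mod.dvdm_def eq_mod_dvd by blast
    from J_add[OF J_I[OF I_const_dvd[OF this]] J_mult[OF h(1), of k]]
    have "J 1" by (simp add: algebra_simps)
    then obtain a where "I (1 - a * f)" unfolding J_def by blast
    from mod_ideal_add[OF mod_ideal_mult[OF this, of g] mod_ideal_mult[OF fg, of a]]
    have "I g" by (simp add: algebra_simps)
    with ng show False ..
  next
    assume "poly_mod.dvdm (int p) q 1"
    then obtain k where "[:int p:] dvd 1 - q * k" unfolding poly_mod.dvdm_def eq_mod_dvd by blast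
    hence 1: "I (h * (1 - q * k))" by (intro mod_ideal_mult I_const_dvd)
    have "C - r = h * q" using qr(1) by simp
    hence "I (h * q)" using mod_ideal_diff[OF I_C I_const_dvd[OF r]] by simp
    hence "I (k * (h * q))" by (rule mod_ideal_mult)
    from mod_ideal_add[OF 1 this] have Ih: "I h" by (simp add: algebra_simps)
    obtain q' r' where qr': "f = h * q' + r'" "r' = 0 \<or> degree r' < degree h"
      using monic_division[OF h(2)] by blast
    have "J r'" using J_diff[OF J_f J_mult[OF h(1), of q']] qr'(1) by (simp add: algebra_simps)
    with small qr' have "I r'" by (intro I_const_dvd) blast
    from mod_ideal_add[OF mod_ideal_mult[OF Ih, of q'] this] have "I f"
      using qr'(1) by (simp add: mult.commute)
    with nf show False ..
  qed
qed

lemma I_prod: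
  assumes "finite A" "I (\<Prod>i\<in>A. f i)"
  shows "\<exists>i\<in>A. I (f i)"
  using assms by (induction A rule: finite_induct) (auto dest: I_prime simp: I_1)

text \<open>A complete system of representatives of the residue ring, by
  \<open>residues_I_eqI\<close> and \<open>residues_I_exists\<close>.\<close>

definition residues_I :: "int poly set" where
  "residues_I = {f. (\<forall>i. 0 \<le> coeff f i \<and> coeff f i < int p) \<and> (\<forall>i\<ge>degree C. coeff f i = 0)}"

lemma residues_I_image:
  "residues_I = Poly ` {xs. set xs \<subseteq> {0..<int p} \<and> length xs = degree C}" (is "_ = Poly ` ?L")
proof (intro equalityI subsetI)
  fix f assume f: "f \<in> residues_I"
  let ?xs = "map (coeff f) [0..<degree C]"
  have "f = Poly ?xs"
    using f by (intro poly_eqI) (auto simp: coeff_Poly_eq nth_default_def residues_I_def)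
  moreover have "?xs \<in> ?L" using f by (auto simp: residues_I_def)
  ultimately show "f \<in> Poly ` ?L" by blast
next
  fix f assume "f \<in> Poly ` ?L"
  then obtain xs where xs: "f = Poly xs" "set xs \<subseteq> {0..<int p}" "length xs = degree C" by auto
  have "xs ! i \<in> {0..<int p}" if "i < length xs" for i using xs(2) that nth_mem by blast
  thus "f \<in> residues_I" using xs p
    by (auto simp: residues_I_def coeff_Poly_eq nth_default_def prime_gt_0_nat)
qed

lemma card_residues_I: "card residues_I = p ^ degree C"
proof -
  have "inj_on Poly {xs. set xs \<subseteq> {0..<int p} \<and> length xs = degree C}"
  proof (rule inj_onI, clarify)
    fix xs ys :: "int list"
    assume *: "length xs = degree C" "length ys = degree C" "Poly xs = Poly ys"
    show "xs = ys"
    proof (rule nth_equalityI)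
      fix i assume "i < length xs"
      moreover have "nth_default 0 xs i = nth_default 0 ys i"
        using *(3) by (metis coeff_Poly_eq)
      ultimately show "xs ! i = ys ! i" using * by (simp add: nth_default_def)
    qed (use * in simp)
  qed
  thus ?thesis unfolding residues_I_image by (simp add: card_image card_lists_length_eq)
qed

lemma finite_residues_I: "finite residues_I"
  unfolding residues_I_image by (intro finite_imageI finite_lists_length_eq) auto

lemma zero_in_residues_I: "0 \<in> residues_I"
  using p by (auto simp: residues_I_def prime_gt_0_nat)

lemma residues_I_eqI:
  assumes "f \<in> residues_I" "g \<in> residues_I" "I (f - g)"
  shows "f = g"
proof -
  have "degree (f - g) < degree C \<or> f - g = 0"
    using assms(1,2) by (intro disjI1 degree_lessI[OF disjI2[OF deg]]) (auto simp: residues_I_def)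
  from mod_ideal_degree_less[OF monic assms(3) this] have "int p dvd coeff f n - coeff g n" for n
    by (auto simp: const_poly_dvd_iff)
  hence "coeff f n mod int p = coeff g n mod int p" for n by (simp add: mod_eq_dvd_iff)
  thus ?thesis using assms(1,2) by (intro poly_eqI) (simp add: residues_I_def)
qed

lemma residues_I_exists: "\<exists>s\<in>residues_I. I (f - s)"
proof -
  interpret poly_mod "int p" .
  obtain q r where qr: "f = C * q + r" "r = 0 \<or> degree r < degree C"
    using monic_division[OF monic] by blast
  have "Mp r \<in> residues_I"
    using p qr(2) by (auto simp: residues_I_def Mp_coeff M_def prime_gt_0_nat coeff_eq_0)
  moreover have "[:int p:] dvd r - Mp r" unfolding eq_mod_dvd[symmetric] by simp
  hence "I (C * q + (r - Mp r))" using mod_ideal_add[OF mod_ideal_multiple I_const_dvd] by blast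
  hence "I (f - Mp r)" by (simp add: qr(1) algebra_simps)
  ultimately show ?thesis by blast
qed

text \<open>Multiplication by \<open>f\<close> permutes the nonzero residue classes, as in Euler's theorem.\<close>
lemma I_power_card: "I (f ^ (p ^ degree C) - f)"
proof (cases "I f")
  case True
  have "p ^ degree C = Suc (p ^ degree C - 1)" using p by (simp add: prime_gt_0_nat)
  hence "I (f ^ (p ^ degree C))" using mod_ideal_mult[OF True] by (metis power_Suc2)
  thus ?thesis using True by (rule mod_ideal_diff)
next
  case False
  let ?S = "residues_I - {0}"
  obtain \<tau> where \<tau>: "\<And>t. \<tau> t \<in> residues_I" "\<And>t. I (f * t - \<tau> t)"
    using bchoice[of UNIV "\<lambda>t s. s \<in> residues_I \<and> I (f * t - s)"] residues_I_exists by blast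
  have nz: "\<not> I t" if "t \<in> ?S" for t
    using that residues_I_eqI[of t 0] zero_in_residues_I by auto
  have "\<tau> ` ?S \<subseteq> ?S"
  proof (rule image_subsetI)
    fix t assume t: "t \<in> ?S"
    have "\<tau> t \<noteq> 0" using \<tau>(2)[of t] I_prime[of f t] False nz[of t] t by auto
    thus "\<tau> t \<in> ?S" using \<tau>(1) by auto
  qed
  moreover have "inj_on \<tau> ?S"
  proof (rule inj_onI)
    fix s t assume st: "s \<in> ?S" "t \<in> ?S" "\<tau> s = \<tau> t"
    have "I (f * s - f * t)"
      using mod_ideal_diff[OF \<tau>(2)[of s] \<tau>(2)[of t]] st(3) by simp
    hence "I (s - t)" using I_prime[of f "s - t"] False by (simp add: algebra_simps)
    thus "s = t" using residues_I_eqI st by auto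
  qed
  ultimately have "bij_betw \<tau> ?S ?S"
    using finite_residues_I by (simp add: bij_betw_def endo_inj_surj)
  hence prod: "(\<Prod>t\<in>?S. \<tau> t) = \<Prod>?S" by (rule prod.reindex_bij_betw)
  have "I ((\<Prod>t\<in>?S. f * t) - (\<Prod>t\<in>?S. \<tau> t))" by (rule mod_ideal_diff_prod) (rule \<tau>)
  hence "I ((f ^ card ?S - 1) * \<Prod>?S)" by (simp add: prod prod.distrib algebra_simps)
  moreover have "\<not> I (\<Prod>?S)" using I_prod[of ?S "\<lambda>t. t"] finite_residues_I nz by auto
  ultimately have "I (f * (f ^ card ?S - 1))" using I_prime mod_ideal_mult by blast
  moreover have "Suc (card ?S) = p ^ degree C"
    using card_residues_I finite_residues_I zero_in_residues_I p
    by (simp add: card_Diff_singleton prime_gt_0_nat)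
  ultimately show ?thesis by (simp add: algebra_simps flip: power_Suc)
qed

end

section \<open>Frobenius modulo a prime and the factorization of \<open>X^p - X\<close>\<close>

lemma prime_dvd_add_power:
  fixes x y :: "'a::comm_ring_1"
  assumes "prime p"
  shows "of_nat p dvd (x + y) ^ p - (x ^ p + y ^ p)"
proof -
  have p: "p > 0" using assms prime_gt_0_nat by blast
  have "(x + y) ^ p = (\<Sum>k\<in>{..p}. of_nat (p choose k) * x ^ k * y ^ (p - k))"
    by (rule binomial_ring)
  also have "{..p} = {0, p} \<union> {0<..<p}" by auto
  also have "(\<Sum>k\<in>{0, p} \<union> {0<..<p}. of_nat (p choose k) * x ^ k * y ^ (p - k))
      = (x ^ p + y ^ p) + (\<Sum>k\<in>{0<..<p}. of_nat (p choose k) * x ^ k * y ^ (p - k))"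
    using p by (subst sum.union_disjoint) (auto simp: add.commute)
  finally have "(x + y) ^ p - (x ^ p + y ^ p) =
      (\<Sum>k\<in>{0<..<p}. of_nat (p choose k) * x ^ k * y ^ (p - k))" by simp
  also have "of_nat p dvd \<dots>"
  proof (intro dvd_sum dvd_mult2)
    fix k assume "k \<in> {0<..<p}"
    hence "p dvd p choose k" using assms by (intro dvd_choose_prime) auto
    thus "of_nat p dvd (of_nat (p choose k) :: 'a)" by (auto elim!: dvdE)
  qed
  finally show ?thesis .
qed

lemma fermat_int:
  assumes "prime p"
  shows "int p dvd a ^ p - a"
proof -
  have nat: "int p dvd int n ^ p - int n" for n
  proof (induction n)
    case 0
    show ?case using prime_gt_0_nat[OF assms] by (simp add: zero_power)
  next
    case (Suc n)
    have "int (Suc n) ^ p - int (Suc n) =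
        ((int n + 1) ^ p - (int n ^ p + 1 ^ p)) + (int n ^ p - int n)" by (simp add: add_ac)
    thus ?case using prime_dvd_add_power[OF assms, of "int n" 1] Suc by (metis dvd_add of_nat_id)
  qed
  \<comment> \<open>Passing to the residue covers negative \<open>a\<close>.\<close>
  define n where "n = nat (a mod int p)"
  have n: "int n = a mod int p" using assms by (simp add: n_def prime_gt_0_nat)
  have "(a ^ p - a) mod int p = (int n ^ p - int n) mod int p"
    unfolding n by (simp add: power_mod mod_diff_eq[symmetric, of "a ^ p"] mod_diff_eq[symmetric, of "(a mod int p) ^ p"])
  thus ?thesis using nat[of n] by (simp add: dvd_eq_mod_eq_0)
qed

text \<open>Modulo \<open>p\<close> the \<open>p\<close>-th power is additive and fixes constants,
  so it acts on \<open>f\<close> as the substitution of \<open>X^p\<close> for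
  \<open>X\<close>.\<close>

lemma frobenius_int_poly:
  fixes f :: "int poly"
  assumes "prime p"
  shows "[:int p:] dvd f ^ p - f \<circ>\<^sub>p ([:0, 1:] ^ p)"
proof (induction f)
  case 0
  show ?case using prime_gt_0_nat[OF assms] by (simp add: zero_power)
next
  case (pCons a f)
  let ?X = "[:0, 1:] :: int poly"
  have eq: "pCons a f = [:a:] + ?X * f" by simp
  have "pCons a f ^ p - pCons a f \<circ>\<^sub>p (?X ^ p) =
      (([:a:] + ?X * f) ^ p - ([:a:] ^ p + (?X * f) ^ p)) + ([:a:] ^ p - [:a:])
       + ?X ^ p * (f ^ p - f \<circ>\<^sub>p (?X ^ p))"
    unfolding pcompose_pCons[of a f] unfolding eq power_mult_distrib
    by (simp add: algebra_simps del: mult_pCons_left mult_pCons_right add_pCons minus_pCons)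
  moreover have "[:int p:] dvd ([:a:] + ?X * f) ^ p - ([:a:] ^ p + (?X * f) ^ p)"
    using prime_dvd_add_power[OF assms, of "[:a:]" "?X * f"] by (simp add: of_nat_poly)
  moreover have "[:int p:] dvd [:a:] ^ p - [:a:]"
    using fermat_int[OF assms, of a] by (simp add: poly_const_pow const_poly_dvd)
  ultimately show ?case using pCons.IH by (simp only: dvd_add dvd_mult)
qed

text \<open>The roots \<open>0, ..., p - 1\<close> are split off one at a time. Modulo
  \<open>p\<close>, \<open>k\<close> is a root of the current product but not of the factors already
  split off, hence a root of \<open>Q\<close>. After \<open>p\<close> steps \<open>Q\<close> is
  monic of degree 0.\<close>

lemma fermat_poly_factorization:
  assumes "prime p"
  shows "[:int p:] dvd [:0, 1:] ^ p - [:0, 1:] - (\<Prod>a<p. [:- int a, 1:])"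
proof -
  let ?X = "[:0, 1:] :: int poly"
  have "\<exists>Q. lead_coeff Q = 1 \<and> degree Q = p - k \<and>
      [:int p:] dvd ?X ^ p - ?X - (\<Prod>a<k. [:- int a, 1:]) * Q" if "k \<le> p" for k
    using that
  proof (induction k)
    case 0
    have X: "degree (?X ^ p - ?X) = p \<and> lead_coeff (?X ^ p - ?X) = 1"
    proof -
      have "degree ?X < degree (?X ^ p)" using prime_gt_1_nat[OF assms] by (simp add: degree_power_eq)
      hence "degree (?X ^ p - ?X) = p"
        using degree_add_eq_left[of "- ?X" "?X ^ p"]
        by (simp add: degree_power_eq del: minus_pCons flip: diff_conv_add_uminus)
      thus ?thesis using prime_gt_1_nat[OF assms]
        by (simp flip: monom_altdef[of "1::int", simplified] add: coeff_pCons split: nat.splits)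
    qed
    show ?case
      by (rule exI[of _ "?X ^ p - ?X"], intro conjI) (use X in \<open>auto simp only: lessThan_0 prod.empty
        mult_1 diff_self dvd_0_right minus_nat.diff_0\<close>)
  next
    case (Suc k)
    then obtain Q where Q: "lead_coeff Q = 1" "degree Q = p - k"
      "[:int p:] dvd ?X ^ p - ?X - (\<Prod>a<k. [:- int a, 1:]) * Q" by auto
    \<comment> \<open>Division by \<open>X - k\<close> leaves the constant remainder
      \<open>poly Q k\<close>, shown below to be divisible by \<open>p\<close>.\<close>
    define S where "S = synthetic_div Q (int k)"
    have QS: "Q = [:- int k, 1:] * S + [:poly Q (int k):]"
      unfolding S_def by (rule synthetic_div_correct'[symmetric])
    have dS: "degree S = p - Suc k" unfolding S_def using Q(2) by (simp add: degree_synthetic_div)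
    have "S \<noteq> 0" unfolding S_def synthetic_div_eq_0_iff using Q(2) Suc.prems by simp
    have "coeff Q (Suc (degree S)) = lead_coeff S"
      by (subst QS) (simp add: coeff_pCons coeff_eq_0)
    moreover have "degree Q = Suc (degree S)" using Q(2) dS Suc.prems by simp
    ultimately have lS: "lead_coeff S = 1" using Q(1) by simp
    have "int p dvd poly (?X ^ p - ?X - (\<Prod>a<k. [:- int a, 1:]) * Q) (int k)"
    proof -
      from Q(3) obtain h where "?X ^ p - ?X - (\<Prod>a<k. [:- int a, 1:]) * Q = smult (int p) h"
        unfolding const_dvd_iff_smult by blast
      thus ?thesis by (simp only: poly_smult dvd_triv_left)
    qed
    hence "int p dvd (int k ^ p - int k) - (\<Prod>a<k. int k - int a) * poly Q (int k)"
      by (simp add: poly_prod)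
    with fermat_int[OF assms, of "int k"]
    have "int p dvd (\<Prod>a<k. int k - int a) * poly Q (int k)"
      by (simp add: dvd_diff_right_iff)
    moreover have "\<not> int p dvd (\<Prod>a<k. int k - int a)"
    proof
      assume "int p dvd (\<Prod>a<k. int k - int a)"
      then obtain a where "a < k" "int p dvd int k - int a"
        using assms by (auto simp: prime_dvd_prod_iff)
      thus False using Suc.prems zdvd_imp_le[of "int p" "int k - int a"] by simp
    qed
    ultimately have "int p dvd poly Q (int k)"
      using assms by (simp add: prime_dvd_mult_iff)
    hence c: "[:int p:] dvd (\<Prod>a<k. [:- int a, 1:]) * [:poly Q (int k):]"
      by (intro dvd_mult) (simp add: const_poly_dvd)
    have "?X ^ p - ?X - (\<Prod>a<Suc k. [:- int a, 1:]) * S =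
        (?X ^ p - ?X - (\<Prod>a<k. [:- int a, 1:]) * ([:- int k, 1:] * S + [:poly Q (int k):])) +
        (\<Prod>a<k. [:- int a, 1:]) * [:poly Q (int k):]"
      by (simp add: algebra_simps del: mult_pCons_left mult_pCons_right)
    also have "[:int p:] dvd \<dots>" using Q(3) c unfolding QS[symmetric] by (rule dvd_add)
    finally show ?case using lS dS by blast
  qed
  from this[of p] obtain Q where Q: "lead_coeff Q = 1" "degree Q = 0"
    "[:int p:] dvd ?X ^ p - ?X - (\<Prod>a<p. [:- int a, 1:]) * Q" by auto
  have "Q = 1" using Q(1,2) by (metis degree_0_id lead_coeff_pCons(2) one_pCons of_int_hom.hom_one)
  thus ?thesis using Q(3) by simp
qed

section \<open>The conjugates of \<open>x\<close> in the residue field\<close>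

context irreducible_modulo
begin

abbreviation (input) X :: "int poly" where "X \<equiv> [:0, 1:]"

text \<open>A class fixed by Frobenius satisfies \<open>f^p = f\<close>. Since
  \<open>f^p - f\<close> is the product of the \<open>f - a\<close> modulo \<open>p\<close> and
  \<open>I\<close> is prime, some \<open>f - a\<close> lies in \<open>I\<close>.\<close>

lemma I_frobenius_fixed:
  assumes "I (f \<circ>\<^sub>p (X ^ p) - f)"
  shows "\<exists>a. I (f - of_int a)"
proof -
  have fixed: "I (f ^ p - f)"
    using mod_ideal_trans[OF I_const_dvd[OF frobenius_int_poly[OF p]] assms] .
  have "[:int p:] dvd (X ^ p - X - (\<Prod>a<p. [:- int a, 1:])) \<circ>\<^sub>p f"
    using fermat_poly_factorization[OF p] unfolding const_dvd_iff_smult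
    by (metis pcompose_smult)
  moreover have "[:- int a, 1:] \<circ>\<^sub>p f = f - of_nat a" for a
    by (simp add: pcompose_pCons of_nat_poly)
  ultimately have "I (f ^ p - f - (\<Prod>a<p. f - of_nat a))"
    by (intro I_const_dvd)
      (simp add: pcompose_diff pcompose_prod pcompose_hom.hom_power pcompose_pCons)
  from mod_ideal_diff[OF fixed this] have "I (\<Prod>a<p. f - of_nat a)" by simp
  then obtain a :: nat where "I (f - of_nat a)" using I_prod[of "{..<p}"] by blast
  thus ?thesis by (intro exI[of _ "int a"]) simp
qed

definition I_cong :: "int poly poly \<Rightarrow> int poly poly \<Rightarrow> bool" where
  "I_cong A B \<longleftrightarrow> (\<forall>n. I (coeff A n - coeff B n))"

lemma I_cong_mult:
  assumes "I_cong A B"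
  shows "I_cong (D * A) (D * B)"
  unfolding I_cong_def
proof
  fix n
  have "coeff (D * A) n - coeff (D * B) n =
      (\<Sum>i\<le>n. coeff D i * (coeff A (n - i) - coeff B (n - i)))"
    by (simp add: coeff_mult sum_subtractf right_diff_distrib)
  also have "I \<dots>" using assms by (intro mod_ideal_sum mod_ideal_mult) (auto simp: I_cong_def)
  finally show "I (coeff (D * A) n - coeff (D * B) n)" .
qed

text \<open>The coefficients are polynomials in \<open>x\<close>, the outer variable is a new one.
  Modulo \<open>I\<close> this turns out to be \<open>C\<close> in the outer variable.\<close>

definition conj_poly :: "int poly poly" where
  "conj_poly = (\<Prod>i<degree C. [:- (X ^ (p ^ i)), 1:])"

text \<open>Frobenius shifts the factors by one index, and the last wraps around to the first
  because \<open>x^(p^d) = x\<close> modulo \<open>I\<close> for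
  \<open>d = degree C\<close>.\<close>

lemma conj_poly_frobenius:
  "I_cong (map_poly (\<lambda>f. f \<circ>\<^sub>p (X ^ p)) conj_poly) conj_poly"
proof -
  interpret \<phi>: map_poly_comm_ring_hom "\<lambda>f::int poly. f \<circ>\<^sub>p (X ^ p)" ..
  define h where "h i = [:- (X ^ (p ^ i)), 1:]" for i
  obtain e where e: "degree C = Suc e" using deg by (cases "degree C") auto
  have h: "map_poly (\<lambda>f. f \<circ>\<^sub>p (X ^ p)) (h i) = h (Suc i)" for i
    by (simp add: h_def pcompose_uminus pcompose_hom.hom_power pcompose_pCons map_poly_pCons
        flip: power_mult)
  have "map_poly (\<lambda>f. f \<circ>\<^sub>p (X ^ p)) conj_poly = (\<Prod>i<Suc e. h (Suc i))"
    by (simp only: conj_poly_def \<phi>.hom_prod e h flip: h_def)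
  also have "\<dots> = (\<Prod>i<e. h (Suc i)) * h (Suc e)" by simp
  finally have 1: "map_poly (\<lambda>f. f \<circ>\<^sub>p (X ^ p)) conj_poly = (\<Prod>i<e. h (Suc i)) * h (Suc e)" .
  have 2: "conj_poly = (\<Prod>i<e. h (Suc i)) * h 0"
    unfolding conj_poly_def e h_def[symmetric] prod.lessThan_Suc_shift by (simp add: mult.commute)
  have "I_cong (h (Suc e)) (h 0)"
    using mod_ideal_minus[OF I_power_card[of X]]
    by (auto simp: I_cong_def h_def e coeff_pCons simp del: minus_pCons split: nat.splits)
  thus ?thesis by (subst 1, subst 2) (rule I_cong_mult)
qed

lemma degree_conj_poly: "degree conj_poly = degree C"
  unfolding conj_poly_def by (simp add: degree_prod_eq_sum_degree)

lemma lead_coeff_conj_poly: "lead_coeff conj_poly = 1"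
  unfolding conj_poly_def by (simp add: lead_coeff_prod)

text \<open>By Frobenius invariance the coefficients are integers \<open>a n\<close> modulo
  \<open>I\<close>. The polynomial \<open>g\<close> formed from them lies in \<open>I\<close>
  because \<open>x\<close> is a root of \<open>conj_poly\<close>; then \<open>C - g\<close> is in
  \<open>I\<close> with degree below that of \<open>C\<close>, hence divisible by
  \<open>p\<close>.\<close>

lemma conj_poly_cong: "I (coeff conj_poly n - of_int (coeff C n))"
proof -
  have "\<exists>a. I (coeff conj_poly n - of_int a)" for n
    using conj_poly_frobenius by (intro I_frobenius_fixed) (auto simp: I_cong_def coeff_map_poly)
  then obtain a where a: "\<And>n. I (coeff conj_poly n - of_int (a n))" by metis
  let ?d = "degree C"
  \<comment> \<open>The leading coefficient is taken to be exactly 1, so that it cancels in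
    \<open>C - g\<close>.\<close>
  define g where "g = (\<Sum>n<?d. monom (a n) n) + monom 1 ?d"
  have "poly conj_poly X = 0"
    unfolding conj_poly_def poly_prod using deg
    by (intro prod_zero) (auto intro!: bexI[of _ 0])
  moreover have "poly conj_poly X = (\<Sum>n<?d. coeff conj_poly n * X ^ n) + X ^ ?d"
    using lead_coeff_conj_poly
    by (simp add: poly_altdef degree_conj_poly flip: lessThan_Suc_atMost)
  moreover have "g = (\<Sum>n<?d. of_int (a n) * X ^ n) + X ^ ?d"
    by (simp add: g_def monom_altdef of_int_poly)
  ultimately have "- g = (\<Sum>n<?d. X ^ n * (coeff conj_poly n - of_int (a n)))"
    by (simp add: algebra_simps sum_subtractf)
  also have "I \<dots>" using a by (intro mod_ideal_sum mod_ideal_mult)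
  finally have "I g" using mod_ideal_minus by fastforce
  hence "I (C - g)" using mod_ideal_multiple[of "int p" C 1] mod_ideal_diff by simp
  moreover have cg: "coeff g n = (if n < ?d then a n else if n = ?d then 1 else 0)" for n
    by (simp add: g_def coeff_sum if_distrib[of "\<lambda>x. x = _"] sum.delta)
  hence "degree (C - g) < ?d"
    using monic by (intro degree_lessI[OF disjI2[OF deg]]) (auto simp: coeff_eq_0)
  ultimately have "[:int p:] dvd C - g" using mod_ideal_degree_less[OF monic] by blast
  hence dvd: "int p dvd coeff C n - coeff g n" for n by (simp add: const_poly_dvd_iff)
  consider "n < ?d" | "n = ?d" | "n > ?d" by linarith
  thus ?thesis
  proof cases
    case 1
    hence "[:int p:] dvd of_int (a n) - of_int (coeff C n)"
      using dvd[of n] cg[of n] by (simp add: of_int_poly const_poly_dvd dvd_diff_commute)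
    from mod_ideal_add[OF a[of n] I_const_dvd[OF this]] show ?thesis by simp
  next
    case 2
    thus ?thesis using monic lead_coeff_conj_poly degree_conj_poly by simp
  next
    case 3
    thus ?thesis using degree_conj_poly by (simp add: coeff_eq_0)
  qed
qed

end

lemma (in irreducible_modulo) I_power_sum:
  assumes "power_sum_fps (fps_of_poly (reflect_poly C)) T" "n > 0"
  shows "I ((\<Sum>i<degree C. X ^ (p ^ i * n)) - of_int (T $ n))"
  unfolding power_mult
proof (rule power_sum_cong_mod[where J = I])
  show "I (coeff (\<Prod>i<degree C. [:- (X ^ p ^ i), 1:]) n - of_int (coeff C n))" for n
    using conj_poly_cong[of n] by (simp only: conj_poly_def)
qed (fact mod_ideal_0 mod_ideal_add mod_ideal_mult monic assms)+

section \<open>From irreducibility modulo \<open>p\<close> to distinct roots in characteristic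
  zero\<close>

text \<open>Up to the sign \<open>s\<close>, \<open>q\<close> is monic. Being a unit modulo
  \<open>p\<close> puts 1 into the ideal \<open>(p, s q)\<close>, which for positive degree would
  make \<open>p\<close> divide 1.\<close>

lemma (in irreducible_modulo) dvdm_1_imp_degree_0:
  assumes "lead_coeff q dvd 1" "poly_mod.dvdm (int p) q 1"
  shows "degree q = 0"
proof (rule ccontr)
  assume q: "degree q \<noteq> 0"
  from assms(1) obtain s where s: "s * lead_coeff q = 1" by (metis dvd_def mult.commute)
  hence s2: "s * s = 1" using zmult_eq_1_iff[of s "lead_coeff q"] by auto
  obtain b where "[:int p:] dvd 1 - q * b"
    using assms(2) unfolding poly_mod.dvdm_def eq_mod_dvd by blast
  then obtain a where a: "1 - q * b = smult (int p) a" unfolding const_dvd_iff_smult by blast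
  have "1 = smult (int p) a + smult s q * smult s b" unfolding a[symmetric] by (simp add: s2)
  hence "mod_ideal (int p) (smult s q) 1" unfolding mod_ideal_def by blast
  moreover have "s \<noteq> 0" using s by auto
  ultimately have "[:int p:] dvd 1"
    using s q by (intro mod_ideal_degree_less[of "smult s q"]) auto
  hence "I 1" by (rule I_const_dvd)
  thus False using I_1 by simp
qed

lemma (in irreducible_modulo) degree_factor:
  assumes "C = a * b"
  shows "degree a = 0 \<or> degree b = 0"
proof -
  have "lead_coeff a * lead_coeff b = 1" using monic assms by (metis lead_coeff_mult)
  hence units: "lead_coeff a dvd 1" "lead_coeff b dvd 1"
    by (metis dvd_triv_left, metis dvd_triv_right)
  have "poly_mod.dvdm (int p) a 1 \<or> poly_mod.dvdm (int p) b 1"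
    using irr assms unfolding poly_mod.irreducible_m_def by metis
  thus ?thesis
    by (elim disjE) (simp_all only: dvdm_1_imp_degree_0[OF units(1)] dvdm_1_imp_degree_0[OF units(2)] simp_thms)
qed

text \<open>Let \<open>g\<close> have least degree among nonzero integer polynomials vanishing at
  \<open>x\<close>. Pseudo-division makes \<open>g\<close> divide a multiple \<open>c * C\<close>,
  Gauss's lemma on primitive parts turns this into an integer factorization of \<open>C\<close>, and
  \<open>degree_factor\<close> forces \<open>g\<close> to have the degree of
  \<open>C\<close>.\<close>

lemma (in irreducible_modulo) degree_le_if_root:
  fixes x :: "'a::field_char_0"
  assumes C: "poly (map_poly of_int C) x = 0"
    and f: "poly (map_poly of_int f) x = 0" "f \<noteq> 0"
  shows "degree C \<le> degree f"
proof -
  define P where "P g \<longleftrightarrow> g \<noteq> 0 \<and> poly (map_poly of_int g) x = 0" for g :: "int poly"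
  have "P f" using f by (simp add: P_def)
  then obtain g where g: "P g" and min: "\<And>h. P h \<Longrightarrow> degree g \<le> degree h"
    using ex_has_least_nat[of P f degree] by blast
  have g0: "g \<noteq> 0" using g by (simp add: P_def)
  obtain q r where qr: "pseudo_divmod C g = (q, r)" by force
  define c where "c = lead_coeff g ^ (Suc (degree C) - degree g)"
  have c0: "c \<noteq> 0" using g0 by (simp add: c_def)
  have qr': "smult c C = g * q + r" "r = 0 \<or> degree r < degree g"
    using pseudo_divmod[OF g0 qr] by (auto simp: c_def)
  have "poly (map_poly of_int (smult c C - g * q)) x = 0"
    using C g by (simp add: P_def hom_distribs)
  hence "poly (map_poly of_int r) x = 0" using qr'(1) by simp
  hence "r = 0" using min[of r] qr'(2) unfolding P_def by fastforce
  hence "primitive_part (smult c C) = primitive_part g * primitive_part q"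
    using qr'(1) by (simp add: primitive_part_mult)
  moreover have "content C = 1"
    using content_dvd_coeff[of C "degree C"] monic normalize_content[of C] by simp
  hence "primitive_part C = C" by (simp add: primitive_part_prim)
  ultimately have "smult (sgn c) C = primitive_part g * primitive_part q"
    by (simp add: primitive_part_smult)
  hence "smult (sgn c) (smult (sgn c) C) = primitive_part g * smult (sgn c) (primitive_part q)"
    by simp
  hence Cgq: "C = primitive_part g * smult (sgn c) (primitive_part q)"
    using c0 by (simp add: sgn_if split: if_splits)
  have "degree g \<noteq> 0"
  proof
    assume "degree g = 0"
    then obtain a where "g = [:a:]" by (rule degree_eq_zeroE)
    thus False using g by (simp add: P_def of_int_hom.map_poly_pCons_hom)
  qed
  hence "degree (smult (sgn c) (primitive_part q)) = 0" using degree_factor[OF Cgq] by simp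
  moreover have "primitive_part g * smult (sgn c) (primitive_part q) \<noteq> 0"
    using deg unfolding Cgq[symmetric] by auto
  ultimately have "degree (primitive_part g * smult (sgn c) (primitive_part q)) = degree g"
    by (subst degree_mult_eq) auto
  hence "degree C = degree g" using Cgq by simp
  thus ?thesis using min[OF \<open>P f\<close>] by simp
qed

text \<open>A repeated root would also be a root of \<open>pderiv C\<close>, which is nonzero of
  smaller degree.\<close>

lemma (in irreducible_modulo) roots_distinct:
  fixes \<alpha> :: "nat \<Rightarrow> 'a::field_char_0"
  assumes roots: "map_poly of_int C = (\<Prod>i<d. [:- \<alpha> i, 1:])"
  shows "inj_on \<alpha> {..<d}"
proof (rule inj_onI, rule ccontr)
  fix i j assume ij: "i \<in> {..<d}" "j \<in> {..<d}" "\<alpha> i = \<alpha> j" "i \<noteq> j"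
  define Q where "Q = (\<Prod>k\<in>{..<d} - {i} - {j}. [:- \<alpha> k, 1:])"
  have "(\<Prod>k<d. [:- \<alpha> k, 1:]) = [:- \<alpha> i, 1:] * (\<Prod>k\<in>{..<d} - {i}. [:- \<alpha> k, 1:])"
    using ij by (intro prod.remove) auto
  also have "(\<Prod>k\<in>{..<d} - {i}. [:- \<alpha> k, 1:]) = [:- \<alpha> j, 1:] * Q"
    unfolding Q_def using ij by (intro prod.remove) auto
  finally have "(\<Prod>k<d. [:- \<alpha> k, 1:]) = [:- \<alpha> i, 1:] * ([:- \<alpha> j, 1:] * Q)" .
  hence C: "map_poly of_int C = [:- \<alpha> i, 1:] * ([:- \<alpha> i, 1:] * Q)" using roots ij(3) by simp
  have "poly (map_poly of_int (pderiv C)) (\<alpha> i) = poly (pderiv (map_poly of_int C)) (\<alpha> i)"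
    by (simp add: of_int_hom.map_poly_pderiv)
  also have "\<dots> = 0" unfolding C by (simp add: pderiv_mult del: mult_pCons_left)
  finally have "degree C \<le> degree (pderiv C)"
    using deg by (intro degree_le_if_root[of "\<alpha> i"]) (auto simp: C pderiv_eq_0_iff)
  thus False using deg by (simp add: degree_pderiv)
qed

section \<open>Roots and recurrences\<close>

text \<open>By linearity powers may be replaced by any polynomial; the one vanishing at all \<alpha>
  values except the \<open>i\<close>-th isolates \<open>w i\<close>.\<close>

lemma sum_power_eq_0_imp_eq_0:
  fixes \<alpha> w :: "nat \<Rightarrow> 'a::idom"
  assumes "\<And>n. (\<Sum>i<d. w i * \<alpha> i ^ n) = 0" "inj_on \<alpha> {..<d}" "i < d"
  shows "w i = 0"
proof -
  have poly0: "(\<Sum>i<d. w i * poly f (\<alpha> i)) = 0" for f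
  proof -
    have "(\<Sum>i<d. w i * poly f (\<alpha> i)) = (\<Sum>k\<le>degree f. coeff f k * (\<Sum>i<d. w i * \<alpha> i ^ k))"
      unfolding poly_altdef sum_distrib_left by (subst sum.swap) (simp add: mult_ac)
    thus ?thesis by (simp add: assms(1))
  qed
  let ?f = "\<Prod>j\<in>{..<d} - {i}. [:- \<alpha> j, 1:]"
  have "poly ?f (\<alpha> k) = 0" if "k < d" "k \<noteq> i" for k
    unfolding poly_prod using that by (intro prod_zero) auto
  hence "(\<Sum>k<d. w k * poly ?f (\<alpha> k)) = (\<Sum>k<d. if k = i then w i * poly ?f (\<alpha> i) else 0)"
    by (intro sum.cong) auto
  hence "w i * poly ?f (\<alpha> i) = 0" using poly0[of ?f] assms(3) by simp
  moreover have "poly ?f (\<alpha> i) \<noteq> 0"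
    using assms(2,3) by (auto simp: poly_prod inj_on_def)
  ultimately show ?thesis by simp
qed

lemma degree_recurrence_poly:
  assumes "d \<ge> 1"
  shows "degree (recurrence_poly d r) = d" "lead_coeff (recurrence_poly d r) = 1"
proof -
  have small: "degree (\<Sum>i=1..d. monom (r i) (d - i)) < d"
    using assms by (intro degree_sum_less) (auto intro: le_less_trans[OF degree_monom_le])
  show deg: "degree (recurrence_poly d r) = d"
    unfolding recurrence_poly_def diff_conv_add_uminus using small
    by (subst degree_add_eq_left) (simp_all add: degree_monom_eq)
  show "lead_coeff (recurrence_poly d r) = 1"
    unfolding deg using small by (simp add: recurrence_poly_def coeff_eq_0)
qed

theorem theorem5:
  fixes d :: nat and r :: "nat \<Rightarrow> int" and U :: "nat \<Rightarrow> int"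
    and \<alpha> l :: "nat \<Rightarrow> complex"
  assumes "d \<ge> 1"
    and "\<forall>n\<ge>d. U n = (\<Sum>i=1..d. r i * U (n - i))"
    and "infinite {p. prime p \<and> irreducible_over_Fp p (recurrence_poly d r)}"
    and "map_poly of_int (recurrence_poly d r) = (\<Prod>i<d. [:- \<alpha> i, 1:])"
    and "\<forall>n. of_int (U n) = (\<Sum>i<d. l i * \<alpha> i ^ n)"
  shows "almost_Dold_condition U \<longleftrightarrow> (\<forall>i<d. \<forall>j<d. l i = l j)"
proof -
  define C where "C = recurrence_poly d r"
  have C: "degree C = d" "lead_coeff C = 1"
    using degree_recurrence_poly[OF assms(1)] by (auto simp: C_def)
  have roots: "map_poly of_int C = (\<Prod>i<d. [:- \<alpha> i, 1:])" using assms(4) by (simp add: C_def)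
  have U: "of_int (U n) = (\<Sum>i<d. l i * \<alpha> i ^ n)" for n using assms(5) by blast
  have loc: "irreducible_modulo p C" if "prime p" "irreducible_over_Fp p C" for p
    using that C assms(1) by unfold_locales (auto simp: irreducible_over_Fp_def)
  have F0: "fps_of_poly (reflect_poly C) $ 0 = 1" using C by simp
  obtain T where T: "power_sum_fps (fps_of_poly (reflect_poly C)) T"
    using power_sum_fps_exists[OF F0] by blast
  \<comment> \<open>Positive \<open>n\<close> is essential: \<open>T $ 0\<close> is 0, while the sum
    of the zeroth powers is \<open>d\<close>.\<close>
  have T_roots: "(\<Sum>i<d. \<alpha> i ^ n) = of_int (T $ n)" if "n > 0" for n
  proof -
    have "coeff (\<Prod>i<d. [:- \<alpha> i, 1:]) n - of_int (coeff C n) = 0" for n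
      unfolding roots[symmetric] by (simp add: coeff_map_poly)
    thus ?thesis
      using power_sum_cong_mod[where J = "\<lambda>x::complex. x = 0" and a = \<alpha>, OF _ _ _ C(2) _ T that]
      by (simp add: C(1))
  qed
  show ?thesis
  proof
    assume eq: "\<forall>i<d. \<forall>j<d. l i = l j"
    have "int d * U n = U 0 * T $ n" if "n \<ge> 1" for n
    proof -
      have l: "(\<Sum>i<d. l i * \<alpha> i ^ m) = l 0 * (\<Sum>i<d. \<alpha> i ^ m)" for m
      proof -
        have "l i * \<alpha> i ^ m = l 0 * \<alpha> i ^ m" if "i \<in> {..<d}" for i
          using eq[rule_format, of i 0] assms(1) that by (simp only: lessThan_iff less_le_trans[OF zero_less_one])
        thus ?thesis unfolding sum_distrib_left by (rule sum.cong[OF refl])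
      qed
      have "of_int (U n) = l 0 * of_int (T $ n)" using U[of n] T_roots[of n] that l[of n] by simp
      moreover have "of_int (U 0) = of_nat d * l 0" using U[of 0] l[of 0] by simp
      ultimately have "(of_int (int d * U n) :: complex) = of_int (U 0 * T $ n)" by simp
      thus ?thesis by (simp only: of_int_eq_iff)
    qed
    hence "Dold_condition (\<lambda>n. int d * U n) \<longleftrightarrow> Dold_condition (\<lambda>n. U 0 * T $ n)"
      by (rule Dold_condition_cong)
    moreover have "Dold_condition (\<lambda>n. U 0 * T $ n)"
      by (intro Dold_condition_cmult power_sum_fps_int_Dold[OF T F0])
    ultimately show "almost_Dold_condition U"
      unfolding almost_Dold_condition_def using assms(1) by blast
  next
    assume "almost_Dold_condition U"
    then obtain c :: nat where c: "c \<ge> 1" "Dold_condition (\<lambda>n. int c * U n)"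
      unfolding almost_Dold_condition_def by blast
    \<comment> \<open>The functional sending \<open>x^k\<close> to \<open>U k\<close>. Written
      through the roots, it visibly vanishes on multiples of \<open>C\<close>; integrality of its
      values is checked separately.\<close>
    define u where "u f = (\<Sum>i<d. l i * poly (map_poly of_int f) (\<alpha> i))" for f :: "int poly"
    have u_int: "u f \<in> \<int>" for f
    proof -
      have "u f = (\<Sum>k\<le>degree f. of_int (coeff f k) * (\<Sum>i<d. l i * \<alpha> i ^ k))"
        unfolding u_def poly_altdef sum_distrib_left
        by (subst sum.swap) (simp add: mult_ac coeff_map_poly)
      also have "\<dots> = of_int (\<Sum>k\<le>degree f. coeff f k * U k)" by (simp add: U)
      finally show ?thesis by (simp only: Ints_of_int)
    qed
    have u_diff: "u (f - g) = u f - u g" for f g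
      by (simp add: u_def hom_distribs sum_subtractf right_diff_distrib)
    have u_sum: "u (\<Sum>i<m. f i) = (\<Sum>i<m. u (f i))" for f and m :: nat
      unfolding u_def by (subst sum.swap) (simp add: hom_distribs poly_sum sum_distrib_left)
    have u_X: "u ([:0, 1:] ^ k) = of_int (U k)" for k
      by (simp add: u_def hom_distribs U of_int_hom.map_poly_pCons_hom)
    have u_of_int: "u (of_int t) = of_int (U 0) * of_int t" for t
      by (simp add: u_def of_int_poly of_int_hom.map_poly_pCons_hom U flip: sum_distrib_right)
    have dvd: "int p dvd int d * U n - U 0 * T $ n"
      if p: "prime p" "irreducible_over_Fp p C" "\<not> p dvd c" and n: "n > 0" for p n
    proof -
      interpret irreducible_modulo p C using p by (intro loc)
      obtain a b where ab: "(\<Sum>i<d. X ^ (p ^ i * n)) - of_int (T $ n) = smult (int p) a + C * b"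
        using I_power_sum[OF T n] unfolding mod_ideal_def C(1) by blast
      have root: "poly (map_poly of_int C) (\<alpha> i) = 0" if "i < d" for i
        unfolding roots poly_prod using that by (intro prod_zero) auto
      obtain z where z: "u a = of_int z" using u_int Ints_cases by metis
      have "of_int ((\<Sum>i<d. U (p ^ i * n)) - U 0 * T $ n)
          = u ((\<Sum>i<d. X ^ (p ^ i * n)) - of_int (T $ n))"
        unfolding u_diff u_sum u_X u_of_int by simp
      also have "\<dots> = of_nat p * u a"
        unfolding ab u_def using root
        by (simp add: hom_distribs sum_distrib_left mult_ac)
      also have "\<dots> = of_int (int p * z)" by (simp add: z)
      finally have "(\<Sum>i<d. U (p ^ i * n)) - U 0 * T $ n = int p * z" by (simp only: of_int_eq_iff)
      \<comment> \<open>The Dold congruences hold for \<open>c * U\<close> only; the factor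
        \<open>c\<close> is cancelled at the end since \<open>p\<close> does not divide it.\<close>
      hence 1: "int p dvd int c * ((\<Sum>i<d. U (p ^ i * n)) - U 0 * T $ n)" by simp
      have "int p dvd (\<Sum>i<d. int c * U (p ^ i * n) - int c * U n)"
        using Dold_condition_prime_power_cong[OF c(2) p(1), of n] n by (intro dvd_sum) auto
      from dvd_diff[OF 1 this] have "int p dvd int c * (int d * U n - U 0 * T $ n)"
        by (simp add: sum_subtractf sum_distrib_left algebra_simps)
      thus ?thesis using that by (simp add: prime_dvd_mult_iff)
    qed
    have eq: "int d * U n = U 0 * T $ n" if n: "n > 0" for n
    proof (rule ccontr)
      assume "int d * U n \<noteq> U 0 * T $ n"
      hence nz: "int d * U n - U 0 * T $ n \<noteq> 0" by simp
      \<comment> \<open>If the difference were nonzero, every such prime would divide it or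
        \<open>c\<close>, leaving finitely many.\<close>
      have "{p. prime p \<and> irreducible_over_Fp p C} \<subseteq>
          {p. p dvd c} \<union> {p. p dvd nat \<bar>int d * U n - U 0 * T $ n\<bar>}"
        using dvd[OF _ _ _ n] by (auto simp: int_dvd_int_iff[symmetric] simp del: int_dvd_int_iff)
      moreover have "finite ({p. p dvd c} \<union> {p. p dvd nat \<bar>int d * U n - U 0 * T $ n\<bar>})"
        using c(1) nz by (intro finite_UnI finite_divisors_nat) auto
      ultimately show False using assms(3) finite_subset unfolding C_def by blast
    qed
    obtain p where p: "prime p" "irreducible_over_Fp p C"
      using assms(3) not_finite_existsD unfolding C_def by blast
    interpret irreducible_modulo p C using p by (intro loc)
    have inj: "inj_on \<alpha> {..<d}" using roots_distinct[OF roots] .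
    have "(\<Sum>i<d. (of_nat d * l i - of_int (U 0)) * \<alpha> i ^ n) = 0" for n
    proof -
      have "(\<Sum>i<d. (of_nat d * l i - of_int (U 0)) * \<alpha> i ^ n)
          = of_nat d * of_int (U n) - of_int (U 0) * (\<Sum>i<d. \<alpha> i ^ n)"
        by (simp add: U sum_subtractf sum_distrib_left algebra_simps)
      also have "\<dots> = 0"
      \<comment> \<open>For \<open>n = 0\<close> both terms are \<open>d * U 0\<close>; the identity
        \<open>eq\<close> covers positive \<open>n\<close>.\<close>
      proof (cases "n = 0")
        case False
        hence "(of_int (int d * U n) :: complex) = of_int (U 0 * T $ n)" using eq by simp
        thus ?thesis using T_roots False by simp
      qed simp
      finally show ?thesis .
    qed
    from sum_power_eq_0_imp_eq_0[OF this inj]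
    have "of_nat d * l i = of_int (U 0)" if "i < d" for i using that by simp
    thus "\<forall>i<d. \<forall>j<d. l i = l j" using assms(1) by (metis mult_cancel_left of_nat_eq_0_iff not_one_le_zero)
  qed
qed

end
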